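(* Let $\mathcal{H}_1,\mathcal{H}_2$ be separable Hilbert spaces, $U\in\mathcal{B}(\mathcal{H}_1,\mathcal{H}_2)$, and let $\Phi=\{\phi_i\}_{i\in I}$ and $\Psi=\{\psi_i\}_{i\in I}$ be Bessel sequences in $\mathcal{H}_2$ and $\mathcal{H}_1$, respectively, such that $\mathbf{G}_{U,\Phi,\Psi}$ is invertible (as a bounded operator on $\ell^2(I)$). Then $\Phi$ and $\Psi$ are Riesz sequences in $\mathcal{H}_2$ and $\mathcal{H}_1$, respectively. If moreover $\Phi$ and $\Psi$ are upper semi-frames, then $\Phi$ and $\Psi$ are Riesz bases (for $\mathcal{H}_2$ and $\mathcal{H}_1$), $U$ is invertible, and in this case $$\left(\mathbf{G}_{U,\Phi,\Psi}\right)^{-1}=\mathbf{G}_{U^{-1},\widetilde{\Psi},\widetilde{\Phi}}.$$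
   Context: All Hilbert spaces are separable, $I$ is a countable index set, $\ell^2=\ell^2(I)$; $\mathcal{B}(\mathcal{H}_1,\mathcal{H}_2)$ is the set of bounded linear operators. A sequence $\Phi=\{\phi_i\}_{i\in I}$ in $\mathcal{H}$ is a Bessel sequence with Bessel bound $B_\Phi>0$ if $\sum_{i}|\langle f,\phi_i\rangle|^2\le B_\Phi\|f\|^2$ for all $f\in\mathcal{H}$, and a frame if moreover $A_\Phi\|f\|^2\le\sum_i|\langle f,\phi_i\rangle|^2$ for some $A_\Phi>0$ and all $f$. An upper semi-frame is a complete Bessel sequence (its linear span is dense). $T_\Phi:\ell^2\to\mathcal{H}$, $T_\Phi\{c_i\}=\sum_i c_i\phi_i$, is the synthesis operator and $S_\Phi=T_\Phi T_\Phi^*$ the frame operator; the canonical dual of a frame is $\widetilde\Phi=\{S_\Phi^{-1}\phi_i\}_i$. A Riesz sequence is a sequence for which there are $A,B>0$ with $A\sum|c_i|^2\le\|\sum c_i\phi_i\|^2\le B\sum|c_i|^2$ for all finite scalar sequences; a Riesz basis is a complete Riesz sequence (equivalently the image of an orthonormal basis under a bounded bijective operator); every Riesz basis is a frame. For Bessel sequences $\Phi$ in $\mathcal{H}_2$, $\Psi$ in $\mathcal{H}_1$, the $U$-cross Gram matrix is $(\mathbf{G}_{U,\Phi,\Psi})_{i,j}=\langle U\psi_j,\phi_i\rangle$, equivalently the bounded operator $T_\Phi^*UT_\Psi$ on $\ell^2$. *)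

theory Defs
  imports "HOL-Analysis.Analysis"
begin

section \<open>Complex inner product spaces\<close>

text \<open>
  A complex inner product space is built on top of its underlying real one, so that norm and
  topology are those of the library; \<open>inner_eq_Re_cinner\<close> ties them to the complex inner
  product, which is linear in the first argument. Positive definiteness is inherited from
  \<^class>\<open>real_inner\<close>. A separable Hilbert space is a type of sort
  \<open>{complex_inner, polish_space}\<close>, i.e. complete and second countable.
\<close>

class complex_inner = real_inner +
  fixes cscale :: "complex \<Rightarrow> 'a \<Rightarrow> 'a" (infixr "*\<^sub>C" 75)
    and cinner :: "'a \<Rightarrow> 'a \<Rightarrow> complex"
  assumes cscale_add_right: "a *\<^sub>C (x + y) = a *\<^sub>C x + a *\<^sub>C y"
    and cscale_add_left: "(a + b) *\<^sub>C x = a *\<^sub>C x + b *\<^sub>C x"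
    and cscale_cscale: "a *\<^sub>C (b *\<^sub>C x) = (a * b) *\<^sub>C x"
    and scaleR_eq_cscale: "r *\<^sub>R x = complex_of_real r *\<^sub>C x"
    and cinner_commute: "cinner x y = cnj (cinner y x)"
    and cinner_add_left: "cinner (x + y) z = cinner x z + cinner y z"
    and cinner_cscale_left: "cinner (a *\<^sub>C x) y = a * cinner x y"
    and inner_eq_Re_cinner: "inner x y = Re (cinner x y)"

lemma cscale_one: "1 *\<^sub>C x = (x :: 'a::complex_inner)"
  using scaleR_eq_cscale[of 1 x] by simp

lemma cinner_self: "cinner x x = complex_of_real ((norm x)\<^sup>2)"
  for x :: "'a::complex_inner"
proof (rule complex_eqI)
  show "Re (cinner x x) = Re (complex_of_real ((norm x)\<^sup>2))"
    by (simp add: power2_norm_eq_inner inner_eq_Re_cinner)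
  show "Im (cinner x x) = Im (complex_of_real ((norm x)\<^sup>2))"
    using arg_cong[OF cinner_commute[of x x], of Im] by simp
qed

global_interpretation cvec: vector_space "cscale :: complex \<Rightarrow> 'a \<Rightarrow> 'a::complex_inner"
  by unfold_locales
    (simp_all add: cscale_add_right cscale_add_left cscale_cscale cscale_one)

section \<open>Bounded operators\<close>

definition bounded_clinear :: "('a::complex_inner \<Rightarrow> 'b::complex_inner) \<Rightarrow> bool" where
  "bounded_clinear f \<longleftrightarrow> bounded_linear f \<and> (\<forall>a x. f (a *\<^sub>C x) = a *\<^sub>C f x)"

text \<open>If \<open>bounded_invertible f\<close> holds, the inverse operator is \<^term>\<open>inv f\<close>.\<close>

definition bounded_invertible :: "('a::complex_inner \<Rightarrow> 'b::complex_inner) \<Rightarrow> bool" where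
  "bounded_invertible f \<longleftrightarrow> bounded_clinear f \<and>
     (\<exists>g. bounded_clinear g \<and> g \<circ> f = id \<and> f \<circ> g = id)"

text \<open>The counterpart of \<^const>\<open>adjoint\<close> for the complex inner product.\<close>

definition cadjoint :: "('a::complex_inner \<Rightarrow> 'b::complex_inner) \<Rightarrow> 'b \<Rightarrow> 'a" where
  "cadjoint f = (SOME g. \<forall>x y. cinner (f x) y = cinner x (g y))"

section \<open>The sequence space\<close>

typedef 'i ell2 = "{c :: 'i \<Rightarrow> complex. (\<lambda>i. (cmod (c i))\<^sup>2) summable_on UNIV}"
  by (rule exI[of _ "\<lambda>_. 0"]) simp

setup_lifting type_definition_ell2

lemma ell2_summable: "(\<lambda>i. (cmod (Rep_ell2 c i))\<^sup>2) summable_on UNIV"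
  using Rep_ell2[of c] by simp

lemma ell2_prod_summable:
  assumes "(\<lambda>i. (cmod (a i))\<^sup>2) summable_on UNIV" "(\<lambda>i. (cmod (b i))\<^sup>2) summable_on UNIV"
  shows "(\<lambda>i. a i * cnj (b i)) summable_on UNIV"
proof -
  have "(\<lambda>i. (cmod (a i))\<^sup>2 + (cmod (b i))\<^sup>2) summable_on UNIV"
    by (intro summable_on_add assms)
  moreover have "norm (a i * cnj (b i)) \<le> (cmod (a i))\<^sup>2 + (cmod (b i))\<^sup>2" for i
  proof -
    have "0 \<le> cmod (a i) * cmod (b i)"
      by simp
    then have "cmod (a i) * cmod (b i) \<le> (cmod (a i))\<^sup>2 + (cmod (b i))\<^sup>2"
      using sum_squares_bound[of "cmod (a i)" "cmod (b i)"] by linarith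
    then show ?thesis
      by (simp add: norm_mult)
  qed
  ultimately have "(\<lambda>i. norm (a i * cnj (b i))) summable_on UNIV"
    by (rule summable_on_comparison_test) simp_all
  then show ?thesis
    by (rule abs_summable_summable)
qed

instantiation ell2 :: (type) complex_inner
begin

lift_definition zero_ell2 :: "'a ell2" is "\<lambda>_. 0" by simp

lift_definition plus_ell2 :: "'a ell2 \<Rightarrow> 'a ell2 \<Rightarrow> 'a ell2" is "\<lambda>a b i. a i + b i"
proof -
  fix a b :: "'a \<Rightarrow> complex"
  assume a: "(\<lambda>i. (cmod (a i))\<^sup>2) summable_on UNIV" and b: "(\<lambda>i. (cmod (b i))\<^sup>2) summable_on UNIV"
  have "(\<lambda>i. 2 * (cmod (a i))\<^sup>2 + 2 * (cmod (b i))\<^sup>2) summable_on UNIV"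
    by (intro summable_on_add summable_on_cmult_right a b)
  moreover have "(cmod (a i + b i))\<^sup>2 \<le> 2 * (cmod (a i))\<^sup>2 + 2 * (cmod (b i))\<^sup>2" for i
  proof -
    have "(cmod (a i + b i))\<^sup>2 \<le> (cmod (a i) + cmod (b i))\<^sup>2"
      by (intro power_mono norm_triangle_ineq) simp
    then show ?thesis
      using sum_squares_bound[of "cmod (a i)" "cmod (b i)"] by (simp add: power2_sum)
  qed
  ultimately show "(\<lambda>i. (cmod (a i + b i))\<^sup>2) summable_on UNIV"
    by (rule summable_on_comparison_test) simp_all
qed

lift_definition cscale_ell2 :: "complex \<Rightarrow> 'a ell2 \<Rightarrow> 'a ell2" is "\<lambda>z a i. z * a i"
  by (simp add: norm_mult power_mult_distrib summable_on_cmult_right)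

lift_definition cinner_ell2 :: "'a ell2 \<Rightarrow> 'a ell2 \<Rightarrow> complex"
  is "\<lambda>a b. \<Sum>\<^sub>\<infinity>i. a i * cnj (b i)" .

lemma Re_cinner_ell2: "Re (cinner a a) = (\<Sum>\<^sub>\<infinity>i. (cmod (Rep_ell2 a i))\<^sup>2)" for a :: "'a ell2"
proof -
  have "Re (cinner a a) = (\<Sum>\<^sub>\<infinity>i. Re (Rep_ell2 a i * cnj (Rep_ell2 a i)))"
    unfolding cinner_ell2.rep_eq
    by (rule infsum_Re[symmetric]) (intro ell2_prod_summable ell2_summable)
  then show ?thesis
    by (simp only: complex_norm_square[symmetric] Re_complex_of_real)
qed

definition "scaleR r (a :: 'a ell2) = complex_of_real r *\<^sub>C a"
definition "uminus (a :: 'a ell2) = (-1) *\<^sub>C a"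
definition "minus a (b :: 'a ell2) = a + (- b)"
definition "inner a (b :: 'a ell2) = Re (cinner a b)"
definition "norm (a :: 'a ell2) = sqrt (inner a a)"
definition "dist a (b :: 'a ell2) = norm (a - b)"
definition "sgn (a :: 'a ell2) = inverse (norm a) *\<^sub>R a"
definition [code del]:
  "uniformity = (INF e\<in>{0<..}. principal {(x :: 'a ell2, y). dist x y < e})"
definition [code del]:
  "open (S :: 'a ell2 set) \<longleftrightarrow> (\<forall>x\<in>S. \<forall>\<^sub>F (x', y) in uniformity. x' = x \<longrightarrow> y \<in> S)"

instance
proof
  fix a b c :: "'a ell2" and z w :: complex and r s :: real
  show "a + b + c = a + (b + c)" by transfer (simp add: add.assoc)
  show "a + b = b + a" by transfer (simp add: add.commute)
  show "0 + a = a" by transfer simp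
  show "- a + a = 0" unfolding uminus_ell2_def by transfer simp
  show "a - b = a + - b" by (rule minus_ell2_def)
  show cadd: "z *\<^sub>C (a + b) = z *\<^sub>C a + z *\<^sub>C b" by transfer (simp add: distrib_left)
  show caddl: "(z + w) *\<^sub>C a = z *\<^sub>C a + w *\<^sub>C a" by transfer (simp add: distrib_right)
  show cc: "z *\<^sub>C w *\<^sub>C a = (z * w) *\<^sub>C a" by transfer (simp add: mult.assoc)
  show "r *\<^sub>R a = complex_of_real r *\<^sub>C a" by (rule scaleR_ell2_def)
  show "r *\<^sub>R (a + b) = r *\<^sub>R a + r *\<^sub>R b"
    unfolding scaleR_ell2_def by transfer (simp add: distrib_left)
  show "(r + s) *\<^sub>R a = r *\<^sub>R a + s *\<^sub>R a"
    unfolding scaleR_ell2_def by transfer (simp add: distrib_right)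
  show "r *\<^sub>R s *\<^sub>R a = (r * s) *\<^sub>R a"
    unfolding scaleR_ell2_def by transfer (simp add: mult.assoc)
  show "1 *\<^sub>R a = a" unfolding scaleR_ell2_def by transfer simp
  show comm: "cinner a b = cnj (cinner b a)" for a b :: "'a ell2"
  proof -
    have "cnj (cinner b a) = (\<Sum>\<^sub>\<infinity>i. cnj (Rep_ell2 b i * cnj (Rep_ell2 a i)))"
      unfolding cinner_ell2.rep_eq by (rule infsum_cnj[symmetric])
    also have "(\<lambda>i. cnj (Rep_ell2 b i * cnj (Rep_ell2 a i))) = (\<lambda>i. Rep_ell2 a i * cnj (Rep_ell2 b i))"
      by (simp add: mult.commute)
    finally show ?thesis
      by (simp add: cinner_ell2.rep_eq)
  qed
  show add: "cinner (a + b) c = cinner a c + cinner b c"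
    by transfer (simp add: distrib_right infsum_add ell2_prod_summable)
  show scale: "cinner (z *\<^sub>C a) b = z * cinner a b" for z
    by transfer (simp add: mult.assoc infsum_cmult_right')
  show "inner a b = Re (cinner a b)" by (rule inner_ell2_def)
  show "inner a b = inner b a"
    unfolding inner_ell2_def by (subst comm) simp
  show "inner (a + b) c = inner a c + inner b c"
    unfolding inner_ell2_def by (simp add: add)
  show "inner (r *\<^sub>R a) b = r * inner a b"
    unfolding inner_ell2_def scaleR_ell2_def by (simp add: scale)
  have self: "inner a a = (\<Sum>\<^sub>\<infinity>i. (cmod (Rep_ell2 a i))\<^sup>2)"
    unfolding inner_ell2_def by (rule Re_cinner_ell2)
  show "0 \<le> inner a a"
    unfolding self by (rule infsum_nonneg) simp
  show "inner a a = 0 \<longleftrightarrow> a = 0"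
  proof
    assume "inner a a = 0"
    then have "(cmod (Rep_ell2 a i))\<^sup>2 = 0" for i
      unfolding self by (intro nonneg_infsum_le_0D[OF _ ell2_summable]) auto
    then show "a = 0"
      by (intro Rep_ell2_inject[THEN iffD1] ext) (simp add: zero_ell2.rep_eq)
  next
    assume "a = 0"
    then show "inner a a = 0"
      unfolding self by (simp add: zero_ell2.rep_eq)
  qed
  show "norm a = sqrt (inner a a)" by (rule norm_ell2_def)
  show "dist a b = norm (a - b)" by (rule dist_ell2_def)
  show "sgn a = inverse (norm a) *\<^sub>R a" by (rule sgn_ell2_def)
  show "uniformity = (INF e\<in>{0<..}. principal {(x :: 'a ell2, y). dist x y < e})"
    by (rule uniformity_ell2_def)
  show "open S \<longleftrightarrow> (\<forall>x\<in>S. \<forall>\<^sub>F (x', y) in uniformity. x' = x \<longrightarrow> y \<in> S)"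
    for S :: "'a ell2 set"
    by (rule open_ell2_def)
qed

end

lemma norm_ell2: "norm c = sqrt (\<Sum>\<^sub>\<infinity>i. (cmod (Rep_ell2 c i))\<^sup>2)" for c :: "'i ell2"
  unfolding norm_ell2_def inner_ell2_def Re_cinner_ell2 ..

section \<open>Frame theory\<close>

text \<open>Convergence is demanded explicitly because \<^const>\<open>infsum\<close> is \<open>0\<close> on divergent sums.\<close>

definition bessel_seq :: "('i \<Rightarrow> 'a::complex_inner) \<Rightarrow> bool" where
  "bessel_seq \<Phi> \<longleftrightarrow> (\<exists>B>0. \<forall>f. (\<lambda>i. (cmod (cinner f (\<Phi> i)))\<^sup>2) summable_on UNIV \<and>
     (\<Sum>\<^sub>\<infinity>i. (cmod (cinner f (\<Phi> i)))\<^sup>2) \<le> B * (norm f)\<^sup>2)"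

definition complete_seq :: "('i \<Rightarrow> 'a::complex_inner) \<Rightarrow> bool" where
  "complete_seq \<Phi> \<longleftrightarrow> closure (cvec.span (range \<Phi>)) = UNIV"

definition upper_semi_frame :: "('i \<Rightarrow> 'a::complex_inner) \<Rightarrow> bool" where
  "upper_semi_frame \<Phi> \<longleftrightarrow> bessel_seq \<Phi> \<and> complete_seq \<Phi>"

definition riesz_seq :: "('i \<Rightarrow> 'a::complex_inner) \<Rightarrow> bool" where
  "riesz_seq \<Phi> \<longleftrightarrow> (\<exists>A>0. \<exists>B>0. \<forall>F c. finite F \<longrightarrow>
     A * (\<Sum>i\<in>F. (cmod (c i))\<^sup>2) \<le> (norm (\<Sum>i\<in>F. c i *\<^sub>C \<Phi> i))\<^sup>2 \<and>
     (norm (\<Sum>i\<in>F. c i *\<^sub>C \<Phi> i))\<^sup>2 \<le> B * (\<Sum>i\<in>F. (cmod (c i))\<^sup>2))"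

definition riesz_basis :: "('i \<Rightarrow> 'a::complex_inner) \<Rightarrow> bool" where
  "riesz_basis \<Phi> \<longleftrightarrow> riesz_seq \<Phi> \<and> complete_seq \<Phi>"

definition synthesis :: "('i \<Rightarrow> 'a::complex_inner) \<Rightarrow> 'i ell2 \<Rightarrow> 'a" where
  "synthesis \<Phi> c = (\<Sum>\<^sub>\<infinity>i. Rep_ell2 c i *\<^sub>C \<Phi> i)"

definition frame_op :: "('i \<Rightarrow> 'a::complex_inner) \<Rightarrow> 'a \<Rightarrow> 'a" where
  "frame_op \<Phi> = synthesis \<Phi> \<circ> cadjoint (synthesis \<Phi>)"

definition canonical_dual :: "('i \<Rightarrow> 'a::complex_inner) \<Rightarrow> 'i \<Rightarrow> 'a" where
  "canonical_dual \<Phi> i = inv (frame_op \<Phi>) (\<Phi> i)"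

definition cross_gram ::
  "('a::complex_inner \<Rightarrow> 'b::complex_inner) \<Rightarrow> ('i \<Rightarrow> 'b) \<Rightarrow> ('i \<Rightarrow> 'a) \<Rightarrow> 'i \<Rightarrow> 'i \<Rightarrow> complex" where
  "cross_gram U \<Phi> \<Psi> i j = cinner (U (\<Psi> j)) (\<Phi> i)"

text \<open>
  The operator given by an infinite matrix. It is meaningful only if the matrix maps square
  summable sequences to square summable sequences, as cross Gram matrices of Bessel sequences
  with a bounded operator do.
\<close>

definition matrix_op :: "('i \<Rightarrow> 'i \<Rightarrow> complex) \<Rightarrow> 'i ell2 \<Rightarrow> 'i ell2" where
  "matrix_op M c = Abs_ell2 (\<lambda>i. \<Sum>\<^sub>\<infinity>j. M i j * Rep_ell2 c j)"

abbreviation cross_gram_op ::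
  "('a::complex_inner \<Rightarrow> 'b::complex_inner) \<Rightarrow> ('i \<Rightarrow> 'b) \<Rightarrow> ('i \<Rightarrow> 'a) \<Rightarrow> 'i ell2 \<Rightarrow> 'i ell2" where
  "cross_gram_op U \<Phi> \<Psi> \<equiv> matrix_op (cross_gram U \<Phi> \<Psi>)"

end

theory Submission
  imports Defs
begin

text \<open>
  Write \<open>T\<^sub>\<Phi>\<close> and \<open>C\<^sub>\<Phi>\<close> for the synthesis and analysis operators of a Bessel sequence \<open>\<Phi>\<close>;
  they are bounded and adjoint to each other. The cross Gram matrix is the operator
  \<open>G = C\<^sub>\<Phi> U T\<^sub>\<Psi>\<close> (\<open>cross_gram_op_eq\<close>). Its inverse \<open>H\<close> makes \<open>R = H C\<^sub>\<Phi> U\<close> a left inverse of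
  \<open>T\<^sub>\<Psi>\<close> and \<open>D = U T\<^sub>\<Psi> H\<close> a right inverse of \<open>C\<^sub>\<Phi>\<close>. The first bounds \<open>T\<^sub>\<Psi>\<close> from below
  directly, the second bounds \<open>T\<^sub>\<Phi>\<close> from below by duality, and a synthesis operator bounded from
  below means a Riesz sequence (\<open>riesz_seqI\<close>).

  If both sequences are complete, put \<open>V = T\<^sub>\<Psi> H C\<^sub>\<Phi>\<close>. Then \<open>V U T\<^sub>\<Psi> = T\<^sub>\<Psi> H G = T\<^sub>\<Psi>\<close>, so the
  continuous operator \<open>V U\<close> is the identity on the dense span of \<open>\<Psi>\<close>, hence everywhere; and
  \<open>C\<^sub>\<Phi> U V = G H C\<^sub>\<Phi> = C\<^sub>\<Phi>\<close>, so \<open>U V\<close> is the identity because the analysis operator of a complete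
  sequence is injective. Thus \<open>U\<close> is invertible with inverse \<open>V\<close>.

  For the formula, both sequences are now frames with injective synthesis operator. Their frame
  operators are coercive, hence onto (\<open>coercive_imp_surj\<close>), from which the canonical dual is
  biorthogonal to the original sequence (\<open>analysis_canonical_dual\<close>). Therefore \<open>V\<close> maps the
  canonical dual of \<open>\<Phi>\<close> at \<open>j\<close> to \<open>T\<^sub>\<Psi> H e\<^sub>j\<close>, and pairing this with the canonical dual of
  \<open>\<Psi>\<close> at \<open>i\<close> yields the matrix entry \<open>(H e\<^sub>j)\<^sub>i\<close>. So the matrix on the right-hand side is the
  matrix of \<open>H\<close>, and expanding a vector in unit vectors (\<open>ell2_expansion\<close>) shows that it acts as \<open>H\<close>.
\<close>

section \<open>Complex inner products\<close>

lemma cinner_cscale_right: "cinner x (a *\<^sub>C y) = cnj a * cinner x y"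
  for x :: "'a::complex_inner"
  by (metis cinner_cscale_left cinner_commute complex_cnj_mult)

lemma norm_cscale: "norm (a *\<^sub>C x) = cmod a * norm x" for x :: "'a::complex_inner"
proof -
  have "complex_of_real ((norm (a *\<^sub>C x))\<^sup>2) = (a * cnj a) * complex_of_real ((norm x)\<^sup>2)"
    by (simp only: cinner_self[symmetric] cinner_cscale_left cinner_cscale_right mult_ac)
  also have "\<dots> = complex_of_real ((cmod a * norm x)\<^sup>2)"
    by (simp only: complex_norm_square[symmetric] power_mult_distrib of_real_mult)
  finally have "(norm (a *\<^sub>C x))\<^sup>2 = (cmod a * norm x)\<^sup>2"
    by (simp only: of_real_eq_iff)
  then show ?thesis
    by simp
qed

text \<open>Rotating \<open>x\<close> by a unimodular scalar makes \<open>cinner x y\<close> real and nonnegative, so the real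
  Cauchy--Schwarz inequality applies.\<close>

lemma cmod_cinner_le: "cmod (cinner x y) \<le> norm x * norm y" for x :: "'a::complex_inner"
proof (cases "cinner x y = 0")
  case False
  define a where "a = cnj (cinner x y) / complex_of_real (cmod (cinner x y))"
  have "cmod a = 1"
    using False by (simp add: a_def norm_divide)
  have "a * cinner x y = complex_of_real (cmod (cinner x y))"
    using False by (simp add: a_def mult.commute[of "cnj _"] power2_eq_square
        flip: complex_norm_square)
  then have "cmod (cinner x y) = inner (a *\<^sub>C x) y"
    by (simp add: inner_eq_Re_cinner cinner_cscale_left)
  also have "\<dots> \<le> norm (a *\<^sub>C x) * norm y"
    by (rule norm_cauchy_schwarz)
  finally show ?thesis
    by (simp add: norm_cscale \<open>cmod a = 1\<close>)
qed simp

text \<open>This transfers bounds between an operator \<open>A\<close> and its adjoint \<open>B\<close>, where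
  \<open>cinner (A c) (A c) = cinner c (B (A c))\<close>: Cauchy--Schwarz leaves a spare factor
  \<open>norm x\<close> on the right, which cancels.\<close>

lemma norm_le_by_duality:
  fixes x :: "'a::complex_inner" and u v :: "'b::complex_inner"
  assumes "cinner x x = cinner u v" and "norm u * norm v \<le> norm x * K" and "0 \<le> K"
  shows "norm x \<le> K"
proof (cases "x = 0")
  case False
  have "norm x * norm x = cmod (cinner x x)"
    by (simp add: cinner_self norm_mult power2_eq_square)
  also have "\<dots> \<le> norm u * norm v"
    by (simp add: assms(1) cmod_cinner_le)
  also note assms(2)
  finally show ?thesis
    using False by simp
qed (use \<open>0 \<le> K\<close> in simp)

lemma bounded_linear_cinner: "bounded_linear (\<lambda>x. cinner x y)" for y :: "'a::complex_inner"
proof (rule bounded_linear_intro)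
  show "norm (cinner x y) \<le> norm x * norm y" for x
    by (rule cmod_cinner_le)
qed (simp_all add: cinner_add_left scaleR_eq_cscale cinner_cscale_left scaleR_conv_of_real)

lemma bounded_linear_cscale: "bounded_linear (\<lambda>x. a *\<^sub>C (x::'a::complex_inner))"
proof (rule bounded_linear_intro)
  show "norm (a *\<^sub>C x) \<le> norm x * cmod a" for x :: 'a
    by (simp add: norm_cscale)
qed (simp_all add: cscale_add_right scaleR_eq_cscale cscale_cscale mult.commute)

lemma cinner_diff_left: "cinner (x - y) z = cinner x z - cinner y z" for z :: "'a::complex_inner"
  by (rule linear_diff[OF bounded_linear.linear[OF bounded_linear_cinner]])

lemma cinner_sum_left: "cinner (sum f F) y = (\<Sum>i\<in>F. cinner (f i) y)" for y :: "'a::complex_inner"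
  by (rule linear_sum[OF bounded_linear.linear[OF bounded_linear_cinner]])

lemma cinner_ext_right:
  fixes x y :: "'a::complex_inner"
  assumes "\<And>z. cinner z x = cinner z y"
  shows "x = y"
proof -
  have "inner (x - y) x = inner (x - y) y"
    by (simp add: inner_eq_Re_cinner assms)
  then have "inner (x - y) (x - y) = 0"
    by (simp add: inner_diff_right)
  then show ?thesis
    by simp
qed

lemma cadjoint_eqI:
  fixes f :: "'a::complex_inner \<Rightarrow> 'b::complex_inner"
  assumes "\<And>x y. cinner (f x) y = cinner x (g y)"
  shows "cadjoint f = g"
proof -
  have "\<forall>x y. cinner (f x) y = cinner x (cadjoint f y)"
    unfolding cadjoint_def by (rule someI[of _ g]) (simp add: assms)
  then show ?thesis
    by (intro ext cinner_ext_right) (metis assms)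
qed

lemma bounded_clinear_compose:
  assumes "bounded_clinear f" "bounded_clinear g"
  shows "bounded_clinear (f \<circ> g)"
  using assms bounded_linear_compose[of f g]
  by (auto simp: bounded_clinear_def o_def)

lemma bounded_clinear_bound:
  assumes "bounded_clinear f"
  shows "\<exists>K>0. \<forall>x. norm (f x) \<le> norm x * K"
  using assms bounded_linear.pos_bounded[of f] by (auto simp: bounded_clinear_def)

text \<open>The Lax--Milgram lemma: for small \<open>t > 0\<close> coercivity makes \<open>x \<mapsto> x - t (S x - g)\<close> a
  contraction, and its fixed point solves \<open>S x = g\<close>.\<close>

lemma coercive_imp_surj:
  fixes S :: "'a::{real_inner,complete_space} \<Rightarrow> 'a"
  assumes S: "bounded_linear S" and "a > 0"
    and coercive: "\<And>x. a * (norm x)\<^sup>2 \<le> inner (S x) x"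
  shows "surj S"
proof -
  interpret S: bounded_linear S by fact
  obtain B0 where "B0 > 0" and B0: "\<And>x. norm (S x) \<le> norm x * B0"
    using S.pos_bounded by blast
  \<comment> \<open>Enlarging the bound to at least \<open>a\<close> keeps the contraction factor real.\<close>
  define B where "B = B0 + a"
  have "B > a" "B > 0"
    using \<open>B0 > 0\<close> \<open>a > 0\<close> by (auto simp: B_def)
  have B: "norm (S x) \<le> norm x * B" for x
    using B0[of x] \<open>a > 0\<close> unfolding B_def
    by (meson add_increasing2 less_imp_le mult_left_mono norm_ge_zero order_refl order_trans)
  \<comment> \<open>This \<open>t\<close> minimises \<open>1 - 2 * t * a + t\<^sup>2 * B\<^sup>2\<close>, the squared contraction factor; \<open>q\<close> is
      the minimum.\<close>
  define t where "t = a / B\<^sup>2"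
  define q where "q = 1 - a\<^sup>2 / B\<^sup>2"
  have "t > 0"
    using \<open>a > 0\<close> \<open>B > 0\<close> by (simp add: t_def)
  have q: "0 \<le> q" "q < 1"
    using \<open>a > 0\<close> \<open>B > a\<close> by (auto simp: q_def divide_simps power_mono)
  have contr: "(norm (x - t *\<^sub>R S x))\<^sup>2 \<le> q * (norm x)\<^sup>2" for x
  proof -
    have "(norm (x - t *\<^sub>R S x))\<^sup>2 = (norm x)\<^sup>2 - 2 * t * inner (S x) x + t\<^sup>2 * (norm (S x))\<^sup>2"
      unfolding power2_norm_eq_inner
      by (simp add: inner_diff_left inner_diff_right inner_commute power2_eq_square algebra_simps)
    also have "\<dots> \<le> (norm x)\<^sup>2 - 2 * t * (a * (norm x)\<^sup>2) + t\<^sup>2 * (norm x * B)\<^sup>2"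
      using coercive[of x] \<open>t > 0\<close> B[of x]
      by (intro add_mono diff_mono mult_left_mono power_mono) auto
    also have "\<dots> = q * (norm x)\<^sup>2"
      using \<open>B > 0\<close> by (simp add: q_def t_def field_simps power2_eq_square)
    finally show ?thesis .
  qed
  have "\<exists>x. S x = g" for g
  proof -
    define F where "F = (\<lambda>x. x - t *\<^sub>R (S x - g))"
    have "dist (F x) (F y) \<le> sqrt q * dist x y" for x y
    proof -
      have "F x - F y = (x - y) - t *\<^sub>R S (x - y)"
        by (simp add: F_def S.diff algebra_simps)
      then have "(dist (F x) (F y))\<^sup>2 \<le> q * (dist x y)\<^sup>2"
        using contr[of "x - y"] by (simp add: dist_norm)
      then have "sqrt ((dist (F x) (F y))\<^sup>2) \<le> sqrt (q * (dist x y)\<^sup>2)"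
        by (rule real_sqrt_le_mono)
      then show ?thesis
        by (simp add: real_sqrt_mult)
    qed
    then have "\<exists>!x. F x = x"
      using q by (intro banach_fix_type[of "sqrt q"]) auto
    then obtain x where "F x = x"
      by blast
    then show ?thesis
      using \<open>t > 0\<close> by (auto simp: F_def)
  qed
  then show ?thesis
    by (metis surjI)
qed

section \<open>Unit vectors of the sequence space\<close>

lift_definition unit_ell2 :: "'i \<Rightarrow> 'i ell2" is "\<lambda>i j. if j = i then 1 else 0"
proof -
  fix i :: 'i
  have "finite {j \<in> UNIV. (cmod (if j = i then 1 else 0))\<^sup>2 \<noteq> 0}"
    by (rule finite_subset[of _ "{i}"]) (auto split: if_splits)
  then show "(\<lambda>j. (cmod (if j = i then 1 else 0))\<^sup>2) summable_on UNIV"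
    by (rule finite_nonzero_values_imp_summable_on)
qed

lemma Rep_ell2_diff: "Rep_ell2 (a - b) i = Rep_ell2 a i - Rep_ell2 b i"
  by (simp only: minus_ell2_def uminus_ell2_def plus_ell2.rep_eq cscale_ell2.rep_eq) simp

lemma Rep_ell2_sum: "Rep_ell2 (sum f F) i = (\<Sum>j\<in>F. Rep_ell2 (f j) i)"
  by (induction F rule: infinite_finite_induct) (simp_all add: zero_ell2.rep_eq plus_ell2.rep_eq)

lemma Rep_ell2_finite_expansion:
  assumes "finite F"
  shows "Rep_ell2 (\<Sum>j\<in>F. c j *\<^sub>C unit_ell2 j) i = (if i \<in> F then c i else 0)"
proof -
  have "Rep_ell2 (\<Sum>j\<in>F. c j *\<^sub>C unit_ell2 j) i = (\<Sum>j\<in>F. if i = j then c j else 0)"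
    by (auto simp: Rep_ell2_sum cscale_ell2.rep_eq unit_ell2.rep_eq intro!: sum.cong)
  then show ?thesis
    using assms by simp
qed

lemma norm_ell2_power2: "(norm c)\<^sup>2 = (\<Sum>\<^sub>\<infinity>i. (cmod (Rep_ell2 c i))\<^sup>2)" for c :: "'i ell2"
  by (simp add: norm_ell2 infsum_nonneg)

lemma norm_finite_expansion:
  assumes "finite F"
  shows "(norm (\<Sum>j\<in>F. c j *\<^sub>C unit_ell2 j))\<^sup>2 = (\<Sum>j\<in>F. (cmod (c j))\<^sup>2)"
proof -
  have "(norm (\<Sum>j\<in>F. c j *\<^sub>C unit_ell2 j))\<^sup>2 = (\<Sum>\<^sub>\<infinity>i\<in>F. (cmod (c i))\<^sup>2)"
    unfolding norm_ell2_power2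
    by (rule infsum_cong_neutral) (auto simp: Rep_ell2_finite_expansion assms)
  then show ?thesis
    using assms by simp
qed

lemma cinner_unit_ell2: "cinner c (unit_ell2 i) = Rep_ell2 c i"
proof -
  have "cinner c (unit_ell2 i) = (\<Sum>\<^sub>\<infinity>j\<in>{i}. Rep_ell2 c j)"
    unfolding cinner_ell2.rep_eq
    by (rule infsum_cong_neutral) (auto simp: unit_ell2.rep_eq)
  then show ?thesis
    by simp
qed

text \<open>By orthogonality the squared distance from \<open>c\<close> to its partial sum over \<open>F\<close> is the tail of
  the convergent series for the squared norm of \<open>c\<close>.\<close>

lemma ell2_expansion: "((\<lambda>i. Rep_ell2 c i *\<^sub>C unit_ell2 i) has_sum c) UNIV"
proof -
  let ?P = "\<lambda>F. \<Sum>i\<in>F. Rep_ell2 c i *\<^sub>C unit_ell2 i"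
  let ?n = "\<lambda>i. (cmod (Rep_ell2 c i))\<^sup>2"
  have tail: "norm (?P F - c) = sqrt ((norm c)\<^sup>2 - sum ?n F)" if "finite F" for F
  proof -
    have "(norm (?P F - c))\<^sup>2 = infsum ?n (UNIV - F)"
      unfolding norm_ell2_power2
      by (rule infsum_cong_neutral) (auto simp: Rep_ell2_diff Rep_ell2_finite_expansion that)
    also have "\<dots> = infsum ?n UNIV - infsum ?n F"
      by (rule infsum_Diff) (use that in \<open>auto intro: ell2_summable\<close>)
    finally have "(norm (?P F - c))\<^sup>2 = (norm c)\<^sup>2 - sum ?n F"
      using that by (simp add: norm_ell2_power2)
    then show ?thesis
      by (metis norm_ge_zero real_sqrt_unique)
  qed
  have "(sum ?n \<longlongrightarrow> (norm c)\<^sup>2) (finite_subsets_at_top UNIV)"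
    using has_sum_infsum[OF ell2_summable[of c]] by (simp add: norm_ell2_power2 has_sum_def)
  then have "((\<lambda>F. sqrt ((norm c)\<^sup>2 - sum ?n F)) \<longlongrightarrow> sqrt ((norm c)\<^sup>2 - (norm c)\<^sup>2))
      (finite_subsets_at_top UNIV)"
    by (intro tendsto_intros)
  then have "((\<lambda>F. norm (?P F - c)) \<longlongrightarrow> 0) (finite_subsets_at_top UNIV)"
    by (subst tendsto_cong[where g = "\<lambda>F. sqrt ((norm c)\<^sup>2 - sum ?n F)"])
      (auto simp: tail intro: eventually_finite_subsets_at_top_weakI)
  then show ?thesis
    unfolding has_sum_def by (simp add: LIM_zero_iff tendsto_norm_zero_iff)
qed

section \<open>Analysis and synthesis operators\<close>

definition analysis :: "('i \<Rightarrow> 'a::complex_inner) \<Rightarrow> 'a \<Rightarrow> 'i ell2" where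
  "analysis \<Phi> f = Abs_ell2 (\<lambda>i. cinner f (\<Phi> i))"

lemma Rep_ell2_analysis:
  assumes "bessel_seq \<Phi>"
  shows "Rep_ell2 (analysis \<Phi> f) i = cinner f (\<Phi> i)"
proof -
  have "(\<lambda>i. (cmod (cinner f (\<Phi> i)))\<^sup>2) summable_on UNIV"
    using assms by (auto simp: bessel_seq_def)
  then show ?thesis
    by (simp add: analysis_def Abs_ell2_inverse)
qed

lemma bounded_clinear_analysis:
  assumes "bessel_seq \<Phi>"
  shows "bounded_clinear (analysis \<Phi>)"
proof -
  note rep = Rep_ell2_analysis[OF assms]
  obtain B where "B > 0" and B: "\<And>f. (\<Sum>\<^sub>\<infinity>i. (cmod (cinner f (\<Phi> i)))\<^sup>2) \<le> B * (norm f)\<^sup>2"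
    using assms by (auto simp: bessel_seq_def)
  have add: "analysis \<Phi> (x + y) = analysis \<Phi> x + analysis \<Phi> y" for x y
    by (rule Rep_ell2_inject[THEN iffD1]) (auto simp: rep plus_ell2.rep_eq cinner_add_left)
  have scale: "analysis \<Phi> (a *\<^sub>C x) = a *\<^sub>C analysis \<Phi> x" for a x
    by (rule Rep_ell2_inject[THEN iffD1]) (auto simp: rep cscale_ell2.rep_eq cinner_cscale_left)
  have "norm (analysis \<Phi> x) \<le> norm x * sqrt B" for x
  proof -
    have "sqrt (\<Sum>\<^sub>\<infinity>i. (cmod (cinner x (\<Phi> i)))\<^sup>2) \<le> sqrt (B * (norm x)\<^sup>2)"
      by (rule real_sqrt_le_mono[OF B])
    then show ?thesis
      by (simp add: norm_ell2 rep real_sqrt_mult mult.commute)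
  qed
  then show ?thesis
    unfolding bounded_clinear_def
    by (auto intro!: bounded_linear_intro add simp: scale scaleR_eq_cscale)
qed

text \<open>On finite sequences synthesis is dual to analysis, so it inherits the bound of the analysis
  operator.\<close>

lemma bessel_seq_finite_bound:
  assumes "bessel_seq \<Phi>"
  obtains K where "K > 0" and
    "\<And>F c. finite F \<Longrightarrow> norm (\<Sum>i\<in>F. c i *\<^sub>C \<Phi> i) \<le> K * norm (\<Sum>i\<in>F. c i *\<^sub>C unit_ell2 i)"
proof -
  obtain K where "K > 0" and K: "\<And>f. norm (analysis \<Phi> f) \<le> norm f * K"
    using bounded_clinear_bound[OF bounded_clinear_analysis[OF assms]] by blast
  have "norm (\<Sum>i\<in>F. c i *\<^sub>C \<Phi> i) \<le> K * norm (\<Sum>i\<in>F. c i *\<^sub>C unit_ell2 i)"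
    (is "norm ?x \<le> K * norm ?c") if "finite F" for F c
  proof (rule norm_le_by_duality)
    have "cinner ?c (analysis \<Phi> ?x) = (\<Sum>i\<in>F. c i * cnj (cinner (analysis \<Phi> ?x) (unit_ell2 i)))"
      by (simp add: cinner_sum_left cinner_cscale_left flip: cinner_commute)
    also have "\<dots> = (\<Sum>i\<in>F. c i * cnj (cinner ?x (\<Phi> i)))"
      by (simp only: cinner_unit_ell2 Rep_ell2_analysis[OF assms])
    also have "\<dots> = cinner ?x ?x"
      using cinner_sum_left[of "\<lambda>i. c i *\<^sub>C \<Phi> i" F ?x]
      by (simp add: cinner_cscale_left flip: cinner_commute)
    finally show "cinner ?x ?x = cinner ?c (analysis \<Phi> ?x)"
      by (rule sym)
    show "norm ?c * norm (analysis \<Phi> ?x) \<le> norm ?x * (K * norm ?c)"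
      using mult_left_mono[OF K[of ?x], of "norm ?c"] by (simp add: mult_ac)
  qed (use \<open>K > 0\<close> in simp)
  with that \<open>K > 0\<close> show ?thesis
    by blast
qed

text \<open>The partial sums of the expansion of \<open>c\<close> in unit vectors form a Cauchy net, and replacing
  unit vectors by the \<open>\<Phi> i\<close> increases distances by at most a constant factor.\<close>

lemma synthesis_summable:
  fixes \<Phi> :: "'i \<Rightarrow> 'a::{complex_inner,complete_space}"
  assumes "bessel_seq \<Phi>"
  shows "(\<lambda>i. Rep_ell2 c i *\<^sub>C \<Phi> i) summable_on UNIV"
proof -
  obtain K where "K > 0" and K: "\<And>F c. finite F \<Longrightarrow>
      norm (\<Sum>i\<in>F. c i *\<^sub>C \<Phi> i) \<le> K * norm (\<Sum>i\<in>F. c i *\<^sub>C unit_ell2 i)"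
    using bessel_seq_finite_bound[OF assms] by blast
  let ?P = "\<lambda>F. \<Sum>i\<in>F. Rep_ell2 c i *\<^sub>C unit_ell2 i"
  let ?T = "\<lambda>F. \<Sum>i\<in>F. Rep_ell2 c i *\<^sub>C \<Phi> i"
  \<comment> \<open>A difference of two partial sums is a single finite combination, to which the bound \<open>K\<close>
      applies.\<close>
  have diff: "sum f F - sum f G
      = (\<Sum>i\<in>F \<union> G. (if i \<in> F then f i else 0) - (if i \<in> G then f i else 0))"
    if "finite F" "finite G" for F G and f :: "'i \<Rightarrow> 'b::ab_group_add"
  proof -
    have "sum f F = (\<Sum>i\<in>F \<union> G. if i \<in> F then f i else 0)"
      "sum f G = (\<Sum>i\<in>F \<union> G. if i \<in> G then f i else 0)"
      using that by (auto intro!: sum.mono_neutral_cong_left)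
    then show ?thesis
      by (simp only: sum_subtractf)
  qed
  have dist_le: "dist (?T F) (?T G) \<le> K * dist (?P F) (?P G)" if "finite F" "finite G" for F G
  proof -
    let ?d = "\<lambda>i. (if i \<in> F then Rep_ell2 c i else 0) - (if i \<in> G then Rep_ell2 c i else 0)"
    have "?T F - ?T G = (\<Sum>i\<in>F \<union> G. ?d i *\<^sub>C \<Phi> i)" "?P F - ?P G = (\<Sum>i\<in>F \<union> G. ?d i *\<^sub>C unit_ell2 i)"
      unfolding diff[OF that]
      by (auto intro!: sum.cong simp: cvec.scale_left_diff_distrib)
    then show ?thesis
      using K[of "F \<union> G" ?d] that by (simp add: dist_norm)
  qed
  have "cauchy_filter (filtermap ?P (finite_subsets_at_top UNIV))"
    using ell2_expansion[of c] by (auto intro!: nhds_imp_cauchy_filter simp: filterlim_def has_sum_def)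
  note * = this[unfolded cauchy_filter_metric_filtermap, rule_format]
  have "cauchy_filter (filtermap ?T (finite_subsets_at_top UNIV))"
    unfolding cauchy_filter_metric_filtermap
  proof (intro allI impI)
    fix e :: real
    assume "e > 0"
    then obtain Q where Q: "eventually Q (finite_subsets_at_top UNIV)"
      and Qd: "\<And>F G. Q F \<Longrightarrow> Q G \<Longrightarrow> dist (?P F) (?P G) < e / K"
      using *[of "e / K"] \<open>K > 0\<close> by auto
    have "eventually (\<lambda>F. Q F \<and> finite F) (finite_subsets_at_top UNIV)"
      using Q by (intro eventually_conj) (auto intro: eventually_finite_subsets_at_top_weakI)
    moreover have "dist (?T F) (?T G) < e" if "Q F \<and> finite F" "Q G \<and> finite G" for F G
    proof -
      have "K * dist (?P F) (?P G) < e"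
        using Qd[of F G] that \<open>K > 0\<close> by (simp add: field_simps)
      then show ?thesis
        using dist_le[of F G] that by simp
    qed
    ultimately show "\<exists>P. eventually P (finite_subsets_at_top UNIV) \<and>
        (\<forall>F G. P F \<and> P G \<longrightarrow> dist (?T F) (?T G) < e)"
      by blast
  qed
  then have "convergent_filter (filtermap ?T (finite_subsets_at_top UNIV))"
    by (rule cauchy_filter_convergent)
  then show ?thesis
    by (auto simp: convergent_filter_iff summable_on_def has_sum_def filterlim_def)
qed

lemma has_sum_synthesis:
  fixes \<Phi> :: "'i \<Rightarrow> 'a::{complex_inner,complete_space}"
  assumes "bessel_seq \<Phi>"
  shows "((\<lambda>i. Rep_ell2 c i *\<^sub>C \<Phi> i) has_sum synthesis \<Phi> c) UNIV"
  unfolding synthesis_def by (rule has_sum_infsum[OF synthesis_summable[OF assms]])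

lemma cinner_synthesis:
  fixes \<Phi> :: "'i \<Rightarrow> 'a::{complex_inner,complete_space}"
  assumes "bessel_seq \<Phi>"
  shows "cinner (synthesis \<Phi> c) f = cinner c (analysis \<Phi> f)"
proof -
  have "((\<lambda>i. cinner (Rep_ell2 c i *\<^sub>C \<Phi> i) f) has_sum cinner (synthesis \<Phi> c) f) UNIV"
    by (rule has_sum_bounded_linear[OF bounded_linear_cinner has_sum_synthesis[OF assms]])
  moreover have "cinner (Rep_ell2 c i *\<^sub>C \<Phi> i) f
      = Rep_ell2 c i * cnj (Rep_ell2 (analysis \<Phi> f) i)" for i
    by (simp add: cinner_cscale_left Rep_ell2_analysis[OF assms] flip: cinner_commute)
  ultimately show ?thesis
    by (simp add: cinner_ell2.rep_eq infsumI)
qed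

lemma cadjoint_synthesis:
  fixes \<Phi> :: "'i \<Rightarrow> 'a::{complex_inner,complete_space}"
  assumes "bessel_seq \<Phi>"
  shows "cadjoint (synthesis \<Phi>) = analysis \<Phi>"
  by (rule cadjoint_eqI) (rule cinner_synthesis[OF assms])

lemma synthesis_finite_expansion:
  assumes "finite F"
  shows "synthesis \<Phi> (\<Sum>i\<in>F. c i *\<^sub>C unit_ell2 i) = (\<Sum>i\<in>F. c i *\<^sub>C \<Phi> i)"
proof -
  have "synthesis \<Phi> (\<Sum>i\<in>F. c i *\<^sub>C unit_ell2 i) = (\<Sum>\<^sub>\<infinity>i\<in>F. c i *\<^sub>C \<Phi> i)"
    unfolding synthesis_def
    by (rule infsum_cong_neutral) (auto simp: Rep_ell2_finite_expansion assms)
  then show ?thesis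
    using assms by simp
qed

lemma synthesis_unit_ell2: "synthesis \<Phi> (unit_ell2 i) = \<Phi> i"
  using synthesis_finite_expansion[of "{i}" \<Phi> "\<lambda>_. 1"] by (simp add: cscale_one)

lemma bounded_clinear_synthesis:
  fixes \<Phi> :: "'i \<Rightarrow> 'a::{complex_inner,complete_space}"
  assumes "bessel_seq \<Phi>"
  shows "bounded_clinear (synthesis \<Phi>)"
proof -
  note summable = synthesis_summable[OF assms]
  obtain K where "K > 0" and K: "\<And>f. norm (analysis \<Phi> f) \<le> norm f * K"
    using bounded_clinear_bound[OF bounded_clinear_analysis[OF assms]] by blast
  have add: "synthesis \<Phi> (x + y) = synthesis \<Phi> x + synthesis \<Phi> y" for x y
    by (simp add: synthesis_def plus_ell2.rep_eq cscale_add_left infsum_add summable)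
  have scale: "synthesis \<Phi> (a *\<^sub>C x) = a *\<^sub>C synthesis \<Phi> x" for a x
    using infsumI[OF has_sum_bounded_linear[OF bounded_linear_cscale has_sum_synthesis[OF assms]], of a x]
    by (simp add: synthesis_def cscale_ell2.rep_eq cscale_cscale)
  have "norm (synthesis \<Phi> c) \<le> norm c * K" for c
  proof (rule norm_le_by_duality)
    show "cinner (synthesis \<Phi> c) (synthesis \<Phi> c) = cinner c (analysis \<Phi> (synthesis \<Phi> c))"
      by (rule cinner_synthesis[OF assms])
    show "norm c * norm (analysis \<Phi> (synthesis \<Phi> c)) \<le> norm (synthesis \<Phi> c) * (norm c * K)"
      using mult_left_mono[OF K[of "synthesis \<Phi> c"], of "norm c"] by (simp add: mult_ac)
  qed (use \<open>K > 0\<close> in simp)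
  then show ?thesis
    unfolding bounded_clinear_def
    by (auto intro!: bounded_linear_intro add simp: scale scaleR_eq_cscale)
qed

section \<open>Complete sequences and Riesz sequences\<close>

lemma complete_seq_bounded_linear_eq:
  fixes f g :: "'a::complex_inner \<Rightarrow> 'b::real_normed_vector"
  assumes "complete_seq \<Phi>" and f: "bounded_linear f" and g: "bounded_linear g"
    and eq: "\<And>a i. f (a *\<^sub>C \<Phi> i) = g (a *\<^sub>C \<Phi> i)"
  shows "f = g"
proof -
  interpret f: bounded_linear f by fact
  interpret g: bounded_linear g by fact
  have "cvec.span (range \<Phi>) \<subseteq> {x. f x = g x}"
  proof
    fix x
    assume "x \<in> cvec.span (range \<Phi>)"
    then have "f x = g x"
      by (induction rule: cvec.span_induct_alt) (auto simp: f.zero g.zero f.add g.add eq)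
    then show "x \<in> {x. f x = g x}"
      by simp
  qed
  moreover have "closed {x. f x = g x}"
    by (intro closed_Collect_eq f.continuous_on g.continuous_on continuous_on_id)
  ultimately have "closure (cvec.span (range \<Phi>)) \<subseteq> {x. f x = g x}"
    by (rule closure_minimal)
  then show ?thesis
    using \<open>complete_seq \<Phi>\<close> by (auto simp: complete_seq_def)
qed

text \<open>A vector with vanishing coefficients is orthogonal to the dense span, hence to itself.\<close>

lemma inj_analysis:
  assumes "bessel_seq \<Phi>" "complete_seq \<Phi>"
  shows "inj (analysis \<Phi>)"
proof (rule injI)
  fix x y
  assume "analysis \<Phi> x = analysis \<Phi> y"
  then have "cinner (x - y) (\<Phi> i) = 0" for i
    using Rep_ell2_analysis[OF assms(1)] by (metis cinner_diff_left right_minus_eq)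
  then have "cinner (a *\<^sub>C \<Phi> i) (x - y) = 0" for a i
    by (metis cinner_commute cinner_cscale_left complex_cnj_zero mult_zero_right)
  then have "(\<lambda>z. cinner z (x - y)) = (\<lambda>z. 0)"
    by (intro complete_seq_bounded_linear_eq[OF assms(2)] bounded_linear_cinner) auto
  then have "cinner (x - y) (x - y) = 0"
    by meson
  then show "x = y"
    by (simp add: cinner_self)
qed

text \<open>Finite sequences are square summable, with synthesis the finite combination, so the Riesz
  inequalities are the bounds of the synthesis operator on finite sequences.\<close>

lemma riesz_seqI:
  fixes \<Phi> :: "'i \<Rightarrow> 'a::{complex_inner,complete_space}"
  assumes "bessel_seq \<Phi>" and "K > 0" and below: "\<And>c. norm c \<le> K * norm (synthesis \<Phi> c)"
  shows "riesz_seq \<Phi>"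
proof -
  obtain L where "L > 0" and L: "\<And>c. norm (synthesis \<Phi> c) \<le> norm c * L"
    using bounded_clinear_bound[OF bounded_clinear_synthesis[OF assms(1)]] by blast
  have "1 / K\<^sup>2 * (\<Sum>i\<in>F. (cmod (c i))\<^sup>2) \<le> (norm (\<Sum>i\<in>F. c i *\<^sub>C \<Phi> i))\<^sup>2 \<and>
      (norm (\<Sum>i\<in>F. c i *\<^sub>C \<Phi> i))\<^sup>2 \<le> L\<^sup>2 * (\<Sum>i\<in>F. (cmod (c i))\<^sup>2)" if "finite F" for F c
  proof -
    let ?c = "\<Sum>i\<in>F. c i *\<^sub>C unit_ell2 i"
    have "(norm ?c)\<^sup>2 \<le> (K * norm (synthesis \<Phi> ?c))\<^sup>2"
      by (intro power_mono below) simp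
    moreover have "(norm (synthesis \<Phi> ?c))\<^sup>2 \<le> (norm ?c * L)\<^sup>2"
      by (intro power_mono L) simp
    ultimately show ?thesis
      using \<open>K > 0\<close>
      by (simp add: synthesis_finite_expansion norm_finite_expansion that power_mult_distrib
          field_simps)
  qed
  then show ?thesis
    unfolding riesz_seq_def using \<open>K > 0\<close> \<open>L > 0\<close>
    by (intro exI[of _ "1 / K\<^sup>2"] conjI exI[of _ "L\<^sup>2"]) auto
qed

text \<open>The lower frame bound makes the frame operator coercive, hence onto, so the canonical
  dual \<open>d\<close> at \<open>i\<close> solves \<open>synthesis \<Phi> (analysis \<Phi> d) = \<Phi> i = synthesis \<Phi> (unit_ell2 i)\<close>;
  cancelling the synthesis operator shows that the canonical dual is biorthogonal to \<open>\<Phi>\<close>.\<close>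

lemma analysis_canonical_dual:
  fixes \<Phi> :: "'i \<Rightarrow> 'a::{complex_inner,complete_space}"
  assumes bessel: "bessel_seq \<Phi>" and inj: "inj (synthesis \<Phi>)"
    and "K > 0" and below: "\<And>f. norm f \<le> K * norm (analysis \<Phi> f)"
  shows "analysis \<Phi> (canonical_dual \<Phi> i) = unit_ell2 i"
proof -
  have S: "frame_op \<Phi> = synthesis \<Phi> \<circ> analysis \<Phi>"
    by (simp add: frame_op_def cadjoint_synthesis[OF bessel])
  have "surj (frame_op \<Phi>)"
  proof (rule coercive_imp_surj)
    show "bounded_linear (frame_op \<Phi>)"
      using bounded_clinear_compose[OF bounded_clinear_synthesis[OF bessel]
          bounded_clinear_analysis[OF bessel]]
      by (simp add: S bounded_clinear_def)
    show "1 / K\<^sup>2 > 0"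
      using \<open>K > 0\<close> by simp
    fix f
    have "(norm f)\<^sup>2 \<le> (K * norm (analysis \<Phi> f))\<^sup>2"
      by (intro power_mono below) simp
    then have "1 / K\<^sup>2 * (norm f)\<^sup>2 \<le> (norm (analysis \<Phi> f))\<^sup>2"
      using \<open>K > 0\<close> by (simp add: power_mult_distrib field_simps)
    also have "\<dots> = inner (frame_op \<Phi> f) f"
      by (simp add: S inner_eq_Re_cinner cinner_synthesis[OF bessel] cinner_self)
    finally show "1 / K\<^sup>2 * (norm f)\<^sup>2 \<le> inner (frame_op \<Phi> f) f" .
  qed
  then have "frame_op \<Phi> (canonical_dual \<Phi> i) = \<Phi> i"
    by (simp add: canonical_dual_def surj_f_inv_f)
  then have "synthesis \<Phi> (analysis \<Phi> (canonical_dual \<Phi> i)) = synthesis \<Phi> (unit_ell2 i)"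
    by (simp add: S synthesis_unit_ell2)
  then show ?thesis
    by (rule injD[OF inj])
qed

section \<open>Cross Gram operators\<close>

text \<open>The \<open>i\<close>-th entry is the bounded functional \<open>\<lambda>x. cinner (U x) (\<Phi> i)\<close> applied to the series
  defining \<open>synthesis \<Psi> c\<close>, and such a functional may be applied termwise.\<close>

lemma cross_gram_op_eq:
  fixes U :: "'a::{complex_inner,complete_space} \<Rightarrow> 'b::{complex_inner,complete_space}"
  assumes "bounded_clinear U" "bessel_seq \<Phi>" "bessel_seq \<Psi>"
  shows "cross_gram_op U \<Phi> \<Psi> = analysis \<Phi> \<circ> U \<circ> synthesis \<Psi>"
proof
  fix c
  have "(\<Sum>\<^sub>\<infinity>j. cinner (U (\<Psi> j)) (\<Phi> i) * Rep_ell2 c j) = cinner (U (synthesis \<Psi> c)) (\<Phi> i)" for i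
  proof -
    have "bounded_linear (\<lambda>x. cinner (U x) (\<Phi> i))"
      using assms(1) by (auto simp: bounded_clinear_def
          intro: bounded_linear_compose[OF bounded_linear_cinner])
    from has_sum_bounded_linear[OF this has_sum_synthesis[OF assms(3)], of c]
    show ?thesis
      using assms(1) by (auto simp: bounded_clinear_def cinner_cscale_left mult.commute dest!: infsumI)
  qed
  then show "cross_gram_op U \<Phi> \<Psi> c = (analysis \<Phi> \<circ> U \<circ> synthesis \<Psi>) c"
    by (simp add: matrix_op_def cross_gram_def analysis_def)
qed

theorem theorem3p7:
  fixes U :: "'a::{complex_inner,polish_space} \<Rightarrow> 'b::{complex_inner,polish_space}"
    and \<Phi> :: "'i::countable \<Rightarrow> 'b"
    and \<Psi> :: "'i \<Rightarrow> 'a"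
  assumes "bounded_clinear U"
    and "bessel_seq \<Phi>" and "bessel_seq \<Psi>"
    and "bounded_invertible (cross_gram_op U \<Phi> \<Psi>)"
  shows "riesz_seq \<Phi> \<and> riesz_seq \<Psi> \<and>
    (upper_semi_frame \<Phi> \<and> upper_semi_frame \<Psi> \<longrightarrow>
       riesz_basis \<Phi> \<and> riesz_basis \<Psi> \<and> bounded_invertible U \<and>
       inv (cross_gram_op U \<Phi> \<Psi>) =
         cross_gram_op (inv U) (canonical_dual \<Psi>) (canonical_dual \<Phi>))"
proof -
  define G where "G = cross_gram_op U \<Phi> \<Psi>"
  have G: "G = analysis \<Phi> \<circ> U \<circ> synthesis \<Psi>"
    unfolding G_def by (rule cross_gram_op_eq) fact+
  obtain H where H: "bounded_clinear H" and HG: "H \<circ> G = id" and GH: "G \<circ> H = id"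
    using assms(4) by (auto simp: bounded_invertible_def G_def)
  note HG' = fun_cong[OF HG, unfolded G o_apply id_apply]
  note GH' = fun_cong[OF GH, unfolded G o_apply id_apply]
  note bounded [intro!] = assms(1) H bounded_clinear_compose
    bounded_clinear_analysis[OF assms(2)] bounded_clinear_analysis[OF assms(3)]
    bounded_clinear_synthesis[OF assms(2)] bounded_clinear_synthesis[OF assms(3)]

  define R where "R = H \<circ> analysis \<Phi> \<circ> U"
  define D where "D = U \<circ> synthesis \<Psi> \<circ> H"
  have R: "bounded_clinear R" and D: "bounded_clinear D"
    by (auto simp: R_def D_def)
  have R_syn: "R (synthesis \<Psi> c) = c" for c
    by (simp add: R_def HG')
  have an_D: "analysis \<Phi> (D c) = c" for c
    by (simp add: D_def GH')
  obtain KR where "KR > 0" and KR: "\<And>x. norm (R x) \<le> norm x * KR"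
    using bounded_clinear_bound[OF R] by blast
  obtain KD where "KD > 0" and KD: "\<And>x. norm (D x) \<le> norm x * KD"
    using bounded_clinear_bound[OF D] by blast
  have below_\<Psi>: "norm c \<le> KR * norm (synthesis \<Psi> c)" for c
    using KR[of "synthesis \<Psi> c"] by (simp add: R_syn mult.commute)
  have below_\<Phi>: "norm c \<le> KD * norm (synthesis \<Phi> c)" for c
  proof (rule norm_le_by_duality)
    show "cinner c c = cinner (synthesis \<Phi> c) (D c)"
      by (simp add: cinner_synthesis[OF assms(2)] an_D)
    show "norm (synthesis \<Phi> c) * norm (D c) \<le> norm c * (KD * norm (synthesis \<Phi> c))"
      using mult_left_mono[OF KD[of c], of "norm (synthesis \<Phi> c)"] by (simp add: mult_ac)
  qed (use \<open>KD > 0\<close> in simp)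
  have riesz: "riesz_seq \<Phi>" "riesz_seq \<Psi>"
    using riesz_seqI below_\<Phi> below_\<Psi> \<open>KR > 0\<close> \<open>KD > 0\<close> assms(2,3) by blast+

  moreover have "riesz_basis \<Phi> \<and> riesz_basis \<Psi> \<and> bounded_invertible U \<and>
       inv G = cross_gram_op (inv U) (canonical_dual \<Psi>) (canonical_dual \<Phi>)"
    if semi: "upper_semi_frame \<Phi>" "upper_semi_frame \<Psi>"
  proof -
    have complete: "complete_seq \<Phi>" "complete_seq \<Psi>"
      using semi by (auto simp: upper_semi_frame_def)
    define V where "V = synthesis \<Psi> \<circ> H \<circ> analysis \<Phi>"
    have V: "bounded_clinear V"
      by (auto simp: V_def)
    have "synthesis \<Psi> \<circ> R = id"
    proof (rule complete_seq_bounded_linear_eq[OF complete(2)])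
      have "synthesis \<Psi> (R (synthesis \<Psi> (a *\<^sub>C unit_ell2 i))) = synthesis \<Psi> (a *\<^sub>C unit_ell2 i)" for a i
        by (simp add: R_syn)
      moreover have "synthesis \<Psi> (a *\<^sub>C unit_ell2 i) = a *\<^sub>C \<Psi> i" for a i
        using bounded_clinear_synthesis[OF assms(3)]
        by (simp add: bounded_clinear_def synthesis_unit_ell2)
      ultimately show "(synthesis \<Psi> \<circ> R) (a *\<^sub>C \<Psi> i) = id (a *\<^sub>C \<Psi> i)" for a i
        by simp
      have "bounded_clinear (synthesis \<Psi> \<circ> R)"
        using R by auto
      then show "bounded_linear (synthesis \<Psi> \<circ> R)"
        by (simp add: bounded_clinear_def)
      show "bounded_linear (id :: 'a \<Rightarrow> 'a)"
        by (simp add: id_def)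
    qed
    then have VU: "V \<circ> U = id" and syn_R: "synthesis \<Psi> (R x) = x" for x
      by (auto simp: V_def R_def fun_eq_iff)
    have UV: "U \<circ> V = id"
    proof
      fix y
      have "analysis \<Phi> (U (V y)) = analysis \<Phi> y"
        by (simp add: V_def GH')
      then show "(U \<circ> V) y = id y"
        using inj_analysis[OF assms(2) complete(1)] by (simp add: inj_eq)
    qed
    have inv_U: "inv U = V"
      using UV VU by (rule inv_unique_comp)
    have inv_G: "inv G = H"
      using GH HG by (rule inv_unique_comp)
    \<comment> \<open>Both analysis operators are bounded from below: that of \<open>\<Phi>\<close> has the left inverse \<open>D\<close>,
        that of \<open>\<Psi>\<close> is adjoint to its synthesis operator, which has the right inverse \<open>R\<close>.\<close>
    have D_an: "D (analysis \<Phi> y) = y" for y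
      using fun_cong[OF UV, of y] by (simp add: V_def D_def)

    have dual_\<Phi>: "analysis \<Phi> (canonical_dual \<Phi> i) = unit_ell2 i" for i
    proof (rule analysis_canonical_dual[OF assms(2) _ \<open>KD > 0\<close>])
      show "inj (synthesis \<Phi>)"
      proof (rule injI)
        fix c d
        assume eq: "synthesis \<Phi> c = synthesis \<Phi> d"
        interpret bounded_linear "synthesis \<Phi>"
          using bounded_clinear_synthesis[OF assms(2)] by (simp add: bounded_clinear_def)
        show "c = d"
          using below_\<Phi>[of "c - d"] eq by (simp add: diff)
      qed
      show "norm y \<le> KD * norm (analysis \<Phi> y)" for y
        using KD[of "analysis \<Phi> y"] by (simp add: D_an mult.commute)
    qed
    have dual_\<Psi>: "analysis \<Psi> (canonical_dual \<Psi> i) = unit_ell2 i" for i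
    proof (rule analysis_canonical_dual[OF assms(3)])
      show "inj (synthesis \<Psi>)"
        by (metis R_syn injI)
      show "KR > 0"
        by fact
      show "norm x \<le> KR * norm (analysis \<Psi> x)" for x
      proof (rule norm_le_by_duality)
        show "cinner x x = cinner (R x) (analysis \<Psi> x)"
          by (simp add: syn_R flip: cinner_synthesis[OF assms(3)])
        show "norm (R x) * norm (analysis \<Psi> x) \<le> norm x * (KR * norm (analysis \<Psi> x))"
          using mult_right_mono[OF KR[of x], of "norm (analysis \<Psi> x)"] by (simp add: mult_ac)
      qed (use \<open>KR > 0\<close> in simp)
    qed

    \<comment> \<open>By biorthogonality the matrix entries are those of \<open>H\<close>.\<close>
    have V_dual: "V (canonical_dual \<Phi> j) = synthesis \<Psi> (H (unit_ell2 j))" for j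
      by (simp add: V_def dual_\<Phi>)
    have "H c = cross_gram_op V (canonical_dual \<Psi>) (canonical_dual \<Phi>) c" for c
    proof -
      have "(\<Sum>\<^sub>\<infinity>j. cinner (V (canonical_dual \<Phi> j)) (canonical_dual \<Psi> i) * Rep_ell2 c j)
          = Rep_ell2 (H c) i" for i
      proof -
        have entry: "cinner (synthesis \<Psi> d) (canonical_dual \<Psi> i) = Rep_ell2 d i" for d
          by (simp add: cinner_synthesis[OF assms(3)] dual_\<Psi> cinner_unit_ell2)
        have "bounded_linear (\<lambda>c. cinner (H c) (unit_ell2 i))"
          using H by (auto simp: bounded_clinear_def
              intro: bounded_linear_compose[OF bounded_linear_cinner])
        from has_sum_bounded_linear[OF this ell2_expansion[of c]]
        have "((\<lambda>j. Rep_ell2 (H (unit_ell2 j)) i * Rep_ell2 c j) has_sum Rep_ell2 (H c) i) UNIV"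
          using H by (simp add: bounded_clinear_def cscale_ell2.rep_eq cinner_unit_ell2 mult.commute)
        then show ?thesis
          by (simp add: V_dual entry infsumI)
      qed
      then show ?thesis
        by (simp add: matrix_op_def cross_gram_def Rep_ell2_inverse)
    qed
    then have "inv G = cross_gram_op (inv U) (canonical_dual \<Psi>) (canonical_dual \<Phi>)"
      by (auto simp: inv_G inv_U)
    moreover have "bounded_invertible U"
      using assms(1) V UV VU by (auto simp: bounded_invertible_def)
    ultimately show ?thesis
      using riesz complete by (simp add: riesz_basis_def)
  qed
  ultimately show ?thesis
    by (simp add: G_def)
qed

end
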